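(* Consider the system of second-order equations $$\ddot q_1-q_1\dot q_3=0,\qquad \ddot q_2-q_2\dot q_3=0,\qquad \ddot q_3+q_1\dot q_1+q_2\dot q_2=0 .$$ The Lie point symmetries of this system are given by $$\mathbf{u}=(-\alpha t+\beta)\frac{\partial}{\partial t}+(\alpha q_1+\gamma q_2)\frac{\partial}{\partial q_1}+(-\gamma q_1+\alpha q_2)\frac{\partial}{\partial q_2}+(\alpha q_3+\delta)\frac{\partial}{\partial q_3},$$ where $\alpha,\beta,\gamma,\delta\in\mathbb{R}$. (That is, a vector field is a Lie point symmetry of the system if and only if it is of this form.)
   Context: A smooth vector field $$\mathbf{u}=\xi(q_1,q_2,q_3,t)\frac{\partial}{\partial t}+\sum_{i=1}^3\eta_i(q_1,q_2,q_3,t)\frac{\partial}{\partial q_i}$$ on $\mathbb{R}^4$ with coordinates $(t,q_1,q_2,q_3)$ is a Lie point symmetry of the system if the action of its second prolongation $$pr^{(2)}(\mathbf{u})=\mathbf{u}+\sum_{i}(\dot\eta_i-\dot\xi\dot q_i)\frac{\partial}{\partial\dot q_i}+\sum_i\left(\ddot\eta_i-\ddot\xi\dot q_i-2\dot\xi\ddot q_i\right)\frac{\partial}{\partial\ddot q_i}$$ on the equations vanishes. Here dots on $\xi,\eta_i$ denote total time derivatives, e.g. $\dot\xi=\frac{\partial\xi}{\partial t}+\sum_j\dot q_j\frac{\partial\xi}{\partial q_j}$. Explicitly, the conditions $$\ddot\eta_1-\ddot\xi\dot q_1-2\ddot q_1\dot\xi-\eta_1\dot q_3-q_1(\dot\eta_3-\dot\xi\dot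 q_3)=0,$$ $$\ddot\eta_2-\ddot\xi\dot q_2-2\ddot q_2\dot\xi-\eta_2\dot q_3-q_2(\dot\eta_3-\dot\xi\dot q_3)=0,$$ $$\ddot\eta_3-\ddot\xi\dot q_3-2\ddot q_3\dot\xi+\eta_1\dot q_1+\eta_2\dot q_2+q_1(\dot\eta_1-\dot\xi\dot q_1)+q_2(\dot\eta_2-\dot\xi\dot q_2)=0$$ must hold identically in the independent variables $t,q_1,q_2,q_3,\dot q_1,\dot q_2,\dot q_3$ after $\ddot q_1,\ddot q_2,\ddot q_3$ have been replaced using the system by $q_1\dot q_3$, $q_2\dot q_3$, $-q_1\dot q_1-q_2\dot q_2$ respectively. *)

theory Defs
  imports "HOL-Analysis.Analysis"
begin

text \<open>Class C^k on the whole space, through iterated derivatives along the basis vectors.\<close>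

fun class_C :: "nat \<Rightarrow> ('a::euclidean_space \<Rightarrow> 'b::real_normed_vector) \<Rightarrow> bool" where
  "class_C 0 f \<longleftrightarrow> continuous_on UNIV f"
| "class_C (Suc k) f \<longleftrightarrow>
     f differentiable_on UNIV \<and>
     (\<forall>e\<in>Basis. class_C k (\<lambda>x. frechet_derivative f (at x) e))"

definition smooth :: "('a::euclidean_space \<Rightarrow> 'b::real_normed_vector) \<Rightarrow> bool" where
  "smooth f \<longleftrightarrow> (\<forall>k. class_C k f)"

text \<open>Points are written (t, q), (t, q, v) and (t, q, v, a), where v and a are the jet
  coordinates for the first and second time derivatives of q.\<close>

type_synonym 'n base = "real \<times> (real^'n)"
type_synonym 'n jet1 = "real \<times> (real^'n) \<times> (real^'n)"
type_synonym 'n jet2 = "real \<times> (real^'n) \<times> (real^'n) \<times> (real^'n)"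

definition partial :: "'a::real_normed_vector \<Rightarrow> ('a \<Rightarrow> real) \<Rightarrow> 'a \<Rightarrow> real" where
  "partial e F x = frechet_derivative F (at x) e"

text \<open>Total time derivatives of a function of (t, q) and of a function of (t, q, v).\<close>

definition total_deriv :: "('n::finite base \<Rightarrow> real) \<Rightarrow> 'n jet1 \<Rightarrow> real" where
  "total_deriv f = (\<lambda>(t, q, v).
     partial (1, 0) f (t, q) + (\<Sum>j\<in>UNIV. v $ j * partial (0, axis j 1) f (t, q)))"

definition total_deriv1 :: "('n::finite jet1 \<Rightarrow> real) \<Rightarrow> 'n jet2 \<Rightarrow> real" where
  "total_deriv1 F = (\<lambda>(t, q, v, a).
     partial (1, 0, 0) F (t, q, v)
     + (\<Sum>j\<in>UNIV. v $ j * partial (0, axis j 1, 0) F (t, q, v))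
     + (\<Sum>j\<in>UNIV. a $ j * partial (0, 0, axis j 1) F (t, q, v)))"

text \<open>The vector field with coefficients \<open>\<xi>\<close> and \<open>\<eta>\<^sub>i\<close> is the map
  (t, q) to \<open>(\<xi>(t, q), \<eta>(t, q))\<close>.\<close>

definition xi :: "('n::finite base \<Rightarrow> 'n base) \<Rightarrow> 'n base \<Rightarrow> real" where
  "xi u x = fst (u x)"

definition eta :: "('n::finite base \<Rightarrow> 'n base) \<Rightarrow> 'n \<Rightarrow> 'n base \<Rightarrow> real" where
  "eta u i x = snd (u x) $ i"

text \<open>The second prolongation of u, applied as a derivation to a function on the second jet
  space.\<close>

definition pr2 :: "('n::finite base \<Rightarrow> 'n base) \<Rightarrow> ('n jet2 \<Rightarrow> real) \<Rightarrow> 'n jet2 \<Rightarrow> real" where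
  "pr2 u F = (\<lambda>(t, q, v, a).
     xi u (t, q) * partial (1, 0, 0, 0) F (t, q, v, a)
     + (\<Sum>i\<in>UNIV. eta u i (t, q) * partial (0, axis i 1, 0, 0) F (t, q, v, a))
     + (\<Sum>i\<in>UNIV.
          (total_deriv (eta u i) (t, q, v) - total_deriv (xi u) (t, q, v) * v $ i)
          * partial (0, 0, axis i 1, 0) F (t, q, v, a))
     + (\<Sum>i\<in>UNIV.
          (total_deriv1 (total_deriv (eta u i)) (t, q, v, a)
            - total_deriv1 (total_deriv (xi u)) (t, q, v, a) * v $ i
            - 2 * total_deriv (xi u) (t, q, v) * a $ i)
          * partial (0, 0, 0, axis i 1) F (t, q, v, a)))"

text \<open>A system is the set of functions on the second jet space that are equated to zero.\<close>

definition lie_point_symmetry ::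
    "('n::finite jet2 \<Rightarrow> real) set \<Rightarrow> ('n base \<Rightarrow> 'n base) \<Rightarrow> bool" where
  "lie_point_symmetry S u \<longleftrightarrow>
     smooth u \<and> (\<forall>p. (\<forall>F\<in>S. F p = 0) \<longrightarrow> (\<forall>F\<in>S. pr2 u F p = 0))"

definition eq1 :: "3 jet2 \<Rightarrow> real" where
  "eq1 = (\<lambda>(t, q, v, a). a $ 1 - q $ 1 * v $ 3)"

definition eq2 :: "3 jet2 \<Rightarrow> real" where
  "eq2 = (\<lambda>(t, q, v, a). a $ 2 - q $ 2 * v $ 3)"

definition eq3 :: "3 jet2 \<Rightarrow> real" where
  "eq3 = (\<lambda>(t, q, v, a). a $ 3 + q $ 1 * v $ 1 + q $ 2 * v $ 2)"

text \<open>For the system of these three equations the symmetry condition is the usual list of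
  determining equations, with the second derivatives eliminated.\<close>

lemma partial_eqI: "(F has_derivative D) (at x) \<Longrightarrow> partial e F x = D e"
  unfolding partial_def by (metis frechet_derivative_at)

lemma partial_eq1:
  "partial (s, x, y, z) eq1 (t, q, v, a) = z $ 1 - x $ 1 * v $ 3 - q $ 1 * y $ 3"
proof -
  have *: "(eq1 has_derivative (\<lambda>(s, x, y, z). z $ 1 - (q $ 1 * y $ 3 + x $ 1 * v $ 3)))
      (at (t, q, v, a))"
    unfolding eq1_def case_prod_unfold
    by (auto intro!: derivative_eq_intros bounded_linear.has_derivative[OF bounded_linear_vec_nth])
  show ?thesis by (subst partial_eqI[OF *]) simp
qed

lemma partial_eq2:
  "partial (s, x, y, z) eq2 (t, q, v, a) = z $ 2 - x $ 2 * v $ 3 - q $ 2 * y $ 3"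
proof -
  have *: "(eq2 has_derivative (\<lambda>(s, x, y, z). z $ 2 - (q $ 2 * y $ 3 + x $ 2 * v $ 3)))
      (at (t, q, v, a))"
    unfolding eq2_def case_prod_unfold
    by (auto intro!: derivative_eq_intros bounded_linear.has_derivative[OF bounded_linear_vec_nth])
  show ?thesis by (subst partial_eqI[OF *]) simp
qed

lemma partial_eq3:
  "partial (s, x, y, z) eq3 (t, q, v, a) =
     z $ 3 + x $ 1 * v $ 1 + q $ 1 * y $ 1 + x $ 2 * v $ 2 + q $ 2 * y $ 2"
proof -
  have *: "(eq3 has_derivative (\<lambda>(s, x, y, z).
      z $ 3 + (q $ 1 * y $ 1 + x $ 1 * v $ 1) + (q $ 2 * y $ 2 + x $ 2 * v $ 2)))
      (at (t, q, v, a))"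
    unfolding eq3_def case_prod_unfold
    by (auto intro!: derivative_eq_intros bounded_linear.has_derivative[OF bounded_linear_vec_nth])
  show ?thesis by (subst partial_eqI[OF *]) simp
qed

lemma lie_point_symmetry_explicit:
  "lie_point_symmetry {eq1, eq2, eq3} u \<longleftrightarrow> smooth u \<and>
    (\<forall>t q v a. a = vector [q$1 * v$3, q$2 * v$3, - q$1 * v$1 - q$2 * v$2] \<longrightarrow>
      (let \<xi>1 = total_deriv (xi u) (t, q, v);
           \<xi>2 = total_deriv1 (total_deriv (xi u)) (t, q, v, a);
           \<eta> = (\<lambda>i. eta u i (t, q));
           \<eta>1 = (\<lambda>i. total_deriv (eta u i) (t, q, v));
           \<eta>2 = (\<lambda>i. total_deriv1 (total_deriv (eta u i)) (t, q, v, a))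
       in \<eta>2 1 - \<xi>2 * v$1 - 2 * a$1 * \<xi>1 - \<eta> 1 * v$3 - q$1 * (\<eta>1 3 - \<xi>1 * v$3) = 0 \<and>
          \<eta>2 2 - \<xi>2 * v$2 - 2 * a$2 * \<xi>1 - \<eta> 2 * v$3 - q$2 * (\<eta>1 3 - \<xi>1 * v$3) = 0 \<and>
          \<eta>2 3 - \<xi>2 * v$3 - 2 * a$3 * \<xi>1 + \<eta> 1 * v$1 + \<eta> 2 * v$2
            + q$1 * (\<eta>1 1 - \<xi>1 * v$1) + q$2 * (\<eta>1 2 - \<xi>1 * v$2) = 0))"
proof -
  have a: "(\<forall>F\<in>{eq1, eq2, eq3}. F (t, q, v, a) = 0) \<longleftrightarrow>
      a = vector [q$1 * v$3, q$2 * v$3, - q$1 * v$1 - q$2 * v$2]" for t q v a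
    by (auto simp: eq1_def eq2_def eq3_def vec_eq_iff forall_3)
  have "pr2 u eq1 (t, q, v, a) =
      total_deriv1 (total_deriv (eta u 1)) (t, q, v, a)
      - total_deriv1 (total_deriv (xi u)) (t, q, v, a) * v$1
      - 2 * a$1 * total_deriv (xi u) (t, q, v) - eta u 1 (t, q) * v$3
      - q$1 * (total_deriv (eta u 3) (t, q, v) - total_deriv (xi u) (t, q, v) * v$3)"
    "pr2 u eq2 (t, q, v, a) =
      total_deriv1 (total_deriv (eta u 2)) (t, q, v, a)
      - total_deriv1 (total_deriv (xi u)) (t, q, v, a) * v$2
      - 2 * a$2 * total_deriv (xi u) (t, q, v) - eta u 2 (t, q) * v$3
      - q$2 * (total_deriv (eta u 3) (t, q, v) - total_deriv (xi u) (t, q, v) * v$3)"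
    "pr2 u eq3 (t, q, v, a) =
      total_deriv1 (total_deriv (eta u 3)) (t, q, v, a)
      - total_deriv1 (total_deriv (xi u)) (t, q, v, a) * v$3
      - 2 * a$3 * total_deriv (xi u) (t, q, v)
      + eta u 1 (t, q) * v$1 + eta u 2 (t, q) * v$2
      + q$1 * (total_deriv (eta u 1) (t, q, v) - total_deriv (xi u) (t, q, v) * v$1)
      + q$2 * (total_deriv (eta u 2) (t, q, v) - total_deriv (xi u) (t, q, v) * v$2)"
    for t q v a
    by (simp_all add: pr2_def partial_eq1 partial_eq2 partial_eq3 sum_3 axis_def algebra_simps)
  then show ?thesis
    unfolding lie_point_symmetry_def split_paired_All a by (simp add: Let_def)
qed

end

theory Submission
  imports Defs
begin

text \<open>
  Everything rests on reading the symmetry condition at a fixed point \<open>(t, q)\<close> as a polynomial in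
  the velocity \<open>v\<close>. Once the accelerations are eliminated they are linear in \<open>v\<close>, so each of the
  three conditions is a cubic polynomial in \<open>v\<close> whose homogeneous parts must vanish separately;
  the parts that enter the argument are the lemmas \<open>determining_cubic\<close>, \<open>determining_quadratic\<close>,
  \<open>determining_linear1\<close> to \<open>determining_linear3\<close> and \<open>determining_constant\<close>.

  The cubic part says that the space Hessian of \<open>\<xi>\<close> vanishes. The quadratic part then prescribes
  all second space derivatives of \<open>\<eta>\<^sub>1\<close> in terms of the space gradient of \<open>\<xi>\<close> and its
  time derivative. Such a prescription
  must be compatible with the equality of the mixed third derivatives of \<open>\<eta>\<^sub>1\<close>, and this forces the
  gradient of \<open>\<xi>\<close> to vanish (\<open>symmetry_time_coefficient\<close>). With \<open>\<xi>\<close> a function of time alone, the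
  quadratic part reads: every \<open>\<eta>\<^sub>i\<close> is affine in \<open>q\<close> (\<open>symmetry_space_coefficients\<close>).

  The remaining unknowns are functions of \<open>t\<close>: the first two derivatives of \<open>\<xi>\<close> and the
  entries \<open>N i j t\<close> of the linear part of \<open>\<eta>\<close>. The linear part of the condition is an identity between
  polynomials in \<open>q\<close> and yields \<open>N 1 1 = N 2 2 = N 3 3 = - \<xi>'\<close>, \<open>N 2 1 = - N 1 2\<close> and zero for
  the other entries; in addition \<open>2 * (N 1 1)' = \<xi>''\<close>, which together with \<open>N 1 1 = - \<xi>'\<close> gives
  \<open>\<xi>'' = 0\<close>. Likewise the linear part gives \<open>(N 1 2)' = 0\<close>, so all entries are constant, and the
  part of degree zero removes the time dependence of \<open>\<eta>\<^sub>3\<close>. What is left is the scaling \<open>\<alpha>\<close>,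
  the rotation \<open>\<gamma>\<close> of the \<open>(q\<^sub>1, q\<^sub>2)\<close>-plane, and the translations \<open>\<beta>\<close> in time and \<open>\<delta>\<close> in \<open>q\<^sub>3\<close>.

  Conversely, an affine field has constant first derivatives, so the three conditions can be
  checked by direct computation.
\<close>

section \<open>Partial derivatives of smooth functions\<close>

lemma smooth_differentiable: "smooth f \<Longrightarrow> f differentiable at x"
proof -
  assume "smooth f"
  then have "class_C (Suc 0) f" unfolding smooth_def by blast
  then show ?thesis by (simp add: differentiable_on_def)
qed

lemma smooth_continuous: "smooth f \<Longrightarrow> isCont f x"
  using smooth_differentiable differentiable_imp_continuous_within by blast

lemma smooth_partial:
  assumes "smooth f" "e \<in> Basis" shows "smooth (partial e f)"
  unfolding smooth_def
proof
  fix k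
  have "class_C (Suc k) f" using assms(1) unfolding smooth_def by blast
  then have "class_C k (\<lambda>x. frechet_derivative f (at x) e)" using assms(2) by simp
  then show "class_C k (partial e f)" unfolding partial_def .
qed

lemma class_C_const: "class_C k (\<lambda>_. c)"
  by (induction k arbitrary: c) simp_all

lemma class_C_bounded_linear:
  assumes L: "bounded_linear L"
  shows "class_C k f \<Longrightarrow> class_C k (\<lambda>x. L (f x))"
proof (induction k arbitrary: f)
  case 0
  then show ?case by (simp add: bounded_linear.continuous_on[OF L])
next
  case (Suc k)
  have "f differentiable at x" for x
    using Suc.prems by (simp add: differentiable_on_def)
  then have "(f has_derivative frechet_derivative f (at x)) (at x)" for x
    by (simp add: frechet_derivative_works)
  then have D: "((\<lambda>x. L (f x)) has_derivative (\<lambda>h. L (frechet_derivative f (at x) h))) (at x)" for x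
    by (rule bounded_linear.has_derivative[OF L])
  then have "frechet_derivative (\<lambda>x. L (f x)) (at x) = (\<lambda>h. L (frechet_derivative f (at x) h))" for x
    by (metis frechet_derivative_at)
  then show ?case
    using D Suc by (auto simp: differentiable_on_def differentiable_def)
qed

lemma smooth_xi: "smooth u \<Longrightarrow> smooth (xi u)"
  unfolding smooth_def xi_def using class_C_bounded_linear[OF bounded_linear_fst] by auto

lemma smooth_eta: "smooth u \<Longrightarrow> smooth (eta u i)"
  unfolding smooth_def eta_def
  using class_C_bounded_linear[OF bounded_linear_compose[OF bounded_linear_vec_nth bounded_linear_snd]]
  by blast

lemma smooth_affine:
  assumes L: "bounded_linear L"
  shows "smooth (\<lambda>x. L x + c)"
  unfolding smooth_def
proof
  fix k
  have D: "((\<lambda>x. L x + c) has_derivative L) (at x)" for x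
    using has_derivative_add[OF bounded_linear_imp_has_derivative[OF L] has_derivative_const] by simp
  then have F: "frechet_derivative (\<lambda>x. L x + c) (at x) = L" for x
    by (metis frechet_derivative_at)
  show "class_C k (\<lambda>x. L x + c)"
  proof (cases k)
    case 0
    then show ?thesis
      using has_derivative_continuous[OF D] by (simp add: continuous_at_imp_continuous_on)
  next
    case (Suc m)
    then show ?thesis
      using D class_C_const by (auto simp: F differentiable_on_def differentiable_def)
  qed
qed

lemma partial_has_derivative: "smooth f \<Longrightarrow> (f has_derivative (\<lambda>h. partial h f x)) (at x)"
  unfolding partial_def using smooth_differentiable frechet_derivative_works by fastforce

lemma partial_const: "partial e (\<lambda>_. c) = (\<lambda>_. 0)"
  by (rule ext) (simp add: partial_eqI[OF has_derivative_const])

lemma partial_affine: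
  assumes "bounded_linear L"
  shows "partial e (\<lambda>x. L x + c) = (\<lambda>_. L e)"
  using partial_eqI[OF has_derivative_add[OF bounded_linear_imp_has_derivative[OF assms] has_derivative_const]]
  by auto

lemma has_real_derivative_along_line:
  assumes "smooth f"
  shows "((\<lambda>s. f (x + s *\<^sub>R e)) has_real_derivative partial e f (x + s *\<^sub>R e)) (at s)"
proof -
  have "((\<lambda>s. x + s *\<^sub>R e) has_derivative (\<lambda>h. h *\<^sub>R e)) (at s)"
    by (auto intro!: derivative_eq_intros)
  from has_derivative_compose[OF this partial_has_derivative[OF assms]]
  have "((\<lambda>s. f (x + s *\<^sub>R e)) has_derivative (\<lambda>h. partial (h *\<^sub>R e) f (x + s *\<^sub>R e))) (at s)" .
  moreover have "partial (h *\<^sub>R e) f y = partial e f y * h" for h y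
    using linear_cmul[OF has_derivative_linear[OF partial_has_derivative[OF assms]]] by simp
  ultimately show ?thesis by (simp add: has_field_derivative_def)
qed

text \<open>The direction \<open>e\<close> is an arbitrary vector here, so a single step along a straight line reaches
  any point; this is how functions are recovered from their partial derivatives below.\<close>

lemma increment_of_constant_partial:
  assumes f: "smooth f" and c: "\<And>s. partial e f (x + s *\<^sub>R e) = c"
  shows "f (x + e) = f x + c"
proof -
  obtain s where "f (x + 1 *\<^sub>R e) - f (x + 0 *\<^sub>R e) = (1 - 0) * partial e f (x + s *\<^sub>R e)"
    using MVT2[OF zero_less_one has_real_derivative_along_line[OF f]] by blast
  then show ?thesis by (simp add: c)
qed

text \<open>The second difference over the parallelogram spanned by \<open>h e\<close> and \<open>h e'\<close> is a first difference
  in direction \<open>e\<close> of first differences in direction \<open>e'\<close>; two applications of the mean value theorem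
  turn it into a second derivative at a point of the parallelogram.\<close>

lemma second_difference_mean_value:
  assumes f: "smooth f" and e: "e \<in> Basis" and h: "0 < h"
  obtains r s where "0 < r" "r < h" "0 < s" "s < h"
    "f (x + h *\<^sub>R e + h *\<^sub>R e') - f (x + h *\<^sub>R e) - f (x + h *\<^sub>R e') + f x
       = h * h * partial e' (partial e f) (x + r *\<^sub>R e + s *\<^sub>R e')"
proof -
  define \<phi> where "\<phi> r = f ((x + h *\<^sub>R e') + r *\<^sub>R e) - f (x + r *\<^sub>R e)" for r
  have D: "DERIV \<phi> r :>
      partial e f ((x + h *\<^sub>R e') + r *\<^sub>R e) - partial e f (x + r *\<^sub>R e)" for r
    unfolding \<phi>_def by (rule DERIV_diff[OF has_real_derivative_along_line[OF f] has_real_derivative_along_line[OF f]])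
  then obtain r where r: "0 < r" "r < h"
    "\<phi> h - \<phi> 0 = (h - 0) * (partial e f ((x + h *\<^sub>R e') + r *\<^sub>R e) - partial e f (x + r *\<^sub>R e))"
    using MVT2[OF h D] by blast
  obtain s where s: "0 < s" "s < h"
    "partial e f (x + r *\<^sub>R e + h *\<^sub>R e') - partial e f (x + r *\<^sub>R e + 0 *\<^sub>R e')
      = (h - 0) * partial e' (partial e f) (x + r *\<^sub>R e + s *\<^sub>R e')"
    using MVT2[OF h has_real_derivative_along_line[OF smooth_partial[OF f e]]] by blast
  have "\<phi> h - \<phi> 0 = h * h * partial e' (partial e f) (x + r *\<^sub>R e + s *\<^sub>R e')"
    using r(3) s(3) by (simp add: algebra_simps)
  moreover have "\<phi> h - \<phi> 0
      = f (x + h *\<^sub>R e + h *\<^sub>R e') - f (x + h *\<^sub>R e) - f (x + h *\<^sub>R e') + f x"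
    by (simp add: \<phi>_def add.commute add.left_commute)
  ultimately show ?thesis using that[OF r(1,2) s(1,2)] by simp
qed

text \<open>Schwarz's theorem. The second difference is symmetric in the two directions, so by the
  previous lemma the two mixed derivatives agree at points arbitrarily close to \<open>x\<close>; by continuity
  they agree at \<open>x\<close>.\<close>

lemma partial_commute:
  assumes f: "smooth f" and e: "e \<in> Basis" and e': "e' \<in> Basis"
  shows "partial e (partial e' f) = partial e' (partial e f)"
proof
  fix x
  let ?A = "partial e (partial e' f)" and ?B = "partial e' (partial e f)"
  have "\<bar>?A x - ?B x\<bar> \<le> 0 + \<epsilon>" if "0 < \<epsilon>" for \<epsilon>
  proof -
    have "isCont ?A x" "isCont ?B x"
      by (rule smooth_continuous, intro smooth_partial f e e')+
    then have "\<exists>d>0. \<forall>y. dist y x < d \<longrightarrow> dist (?A y) (?A x) < \<epsilon> / 2"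
        "\<exists>d>0. \<forall>y. dist y x < d \<longrightarrow> dist (?B y) (?B x) < \<epsilon> / 2"
      using half_gt_zero[OF \<open>0 < \<epsilon>\<close>] unfolding continuous_at_eps_delta by blast+
    then obtain d1 d2 where d: "d1 > 0" "\<And>y. dist y x < d1 \<Longrightarrow> dist (?A y) (?A x) < \<epsilon> / 2"
        "d2 > 0" "\<And>y. dist y x < d2 \<Longrightarrow> dist (?B y) (?B x) < \<epsilon> / 2"
      by blast
    define h where "h = min d1 d2 / 2"
    have h: "0 < h" "2 * h \<le> d1" "2 * h \<le> d2" using d by (auto simp: h_def)
    have near: "dist (x + r *\<^sub>R a + s *\<^sub>R b) x < 2 * h"
      if "0 < r" "r < h" "0 < s" "s < h" "a \<in> Basis" "b \<in> Basis" for r s and a b :: 'a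
    proof -
      have "norm (r *\<^sub>R a + s *\<^sub>R b) \<le> r + s"
        using norm_triangle_ineq[of "r *\<^sub>R a" "s *\<^sub>R b"] that by simp
      then show ?thesis using that by (simp add: dist_norm add.assoc)
    qed
    obtain r s where rs: "0 < r" "r < h" "0 < s" "s < h"
      "f (x + h *\<^sub>R e + h *\<^sub>R e') - f (x + h *\<^sub>R e) - f (x + h *\<^sub>R e') + f x
       = h * h * ?B (x + r *\<^sub>R e + s *\<^sub>R e')"
      using second_difference_mean_value[OF f e h(1)] by blast
    obtain r' s' where rs': "0 < r'" "r' < h" "0 < s'" "s' < h"
      "f (x + h *\<^sub>R e' + h *\<^sub>R e) - f (x + h *\<^sub>R e') - f (x + h *\<^sub>R e) + f x
       = h * h * ?A (x + r' *\<^sub>R e' + s' *\<^sub>R e)"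
      using second_difference_mean_value[OF f e' h(1)] by blast
    have "h * h * ?A (x + r' *\<^sub>R e' + s' *\<^sub>R e) = h * h * ?B (x + r *\<^sub>R e + s *\<^sub>R e')"
    proof -
      have "x + h *\<^sub>R e' + h *\<^sub>R e = x + h *\<^sub>R e + h *\<^sub>R e'" by (simp add: add_ac)
      from rs(5) rs'(5)[unfolded this] show ?thesis by linarith
    qed
    then have "?A (x + r' *\<^sub>R e' + s' *\<^sub>R e) = ?B (x + r *\<^sub>R e + s *\<^sub>R e')" using h(1)
      by (metis mult_cancel_left less_irrefl mult_pos_pos)
    moreover have "dist (?A (x + r' *\<^sub>R e' + s' *\<^sub>R e)) (?A x) < \<epsilon> / 2"
      using d(2) near[OF rs'(1-4) e' e] h by force
    moreover have "dist (?B (x + r *\<^sub>R e + s *\<^sub>R e')) (?B x) < \<epsilon> / 2"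
      using d(4) near[OF rs(1-4) e e'] h by force
    ultimately show ?thesis unfolding dist_real_def by linarith
  qed
  then have "\<bar>?A x - ?B x\<bar> \<le> 0" by (rule field_le_epsilon)
  then show "?A x = ?B x" by simp
qed

section \<open>Functions of time and position\<close>

abbreviation dt :: "('n::finite base \<Rightarrow> real) \<Rightarrow> 'n base \<Rightarrow> real" where
  "dt \<equiv> partial (1, 0)"

abbreviation dq :: "'n::finite \<Rightarrow> ('n base \<Rightarrow> real) \<Rightarrow> 'n base \<Rightarrow> real" where
  "dq j \<equiv> partial (0, axis j 1)"

text \<open>The linear and the quadratic form in the velocity that the first and second space derivatives
  of \<open>f\<close> define. They are the homogeneous pieces of the total time derivatives.\<close>

definition slope :: "('n::finite base \<Rightarrow> real) \<Rightarrow> 'n base \<Rightarrow> real^'n \<Rightarrow> real" where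
  "slope f x v = (\<Sum>j\<in>UNIV. v $ j * dq j f x)"

definition hess :: "('n::finite base \<Rightarrow> real) \<Rightarrow> 'n base \<Rightarrow> real^'n \<Rightarrow> real" where
  "hess f x v = (\<Sum>j\<in>UNIV. v $ j * slope (dq j f) x v)"

lemma time_Basis: "(1, 0) \<in> (Basis :: 'n::finite base set)"
  by (simp add: Basis_prod_def)

lemma space_Basis: "(0, axis j 1) \<in> (Basis :: 'n::finite base set)"
  by (simp add: Basis_prod_def)

lemma smooth_dt: "smooth f \<Longrightarrow> smooth (dt f)"
  by (rule smooth_partial[OF _ time_Basis])

lemma smooth_dq: "smooth f \<Longrightarrow> smooth (dq j f)"
  by (rule smooth_partial[OF _ space_Basis])

lemma dq_dt: "smooth f \<Longrightarrow> dq j (dt f) = dt (dq j f)"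
  by (rule partial_commute[OF _ space_Basis time_Basis])

lemma dq_dq: "smooth f \<Longrightarrow> dq j (dq k f) = dq k (dq j f)"
  by (rule partial_commute[OF _ space_Basis space_Basis])

lemma partial_split:
  fixes f :: "'n::finite base \<Rightarrow> real"
  assumes "smooth f"
  shows "partial (t, v) f x = t * dt f x + slope f x v"
proof -
  interpret D: linear "\<lambda>h. partial h f x"
    by (rule has_derivative_linear[OF partial_has_derivative[OF assms]])
  have "(\<Sum>j\<in>UNIV. v $ j *\<^sub>R axis j (1::real)) = v"
    using basis_expansion[of v] by (simp add: scalar_mult_eq_scaleR)
  then have "(t, v) = t *\<^sub>R (1, 0) + (\<Sum>j\<in>UNIV. v $ j *\<^sub>R (0, axis j 1))"
    by (simp add: prod_eq_iff fst_sum snd_sum)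
  then have "partial (t, v) f x = partial (t *\<^sub>R (1, 0) + (\<Sum>j\<in>UNIV. v $ j *\<^sub>R (0, axis j 1))) f x"
    by simp
  then show ?thesis
    unfolding slope_def by (simp add: D.add D.scale D.sum del: scaleR_Pair)
qed

lemma affine_in_space:
  fixes f :: "'n::finite base \<Rightarrow> real"
  assumes f: "smooth f" and a: "\<And>q j. dq j f (t, q) = a j"
  shows "f (t, q) = f (t, 0) + (\<Sum>j\<in>UNIV. q $ j * a j)"
  using increment_of_constant_partial[OF f, of "(0, q)" "(t, 0)" "\<Sum>j\<in>UNIV. q $ j * a j"]
  by (simp add: partial_split[OF f, of 0 q] slope_def a)

lemma constant_in_space:
  fixes f :: "'n::finite base \<Rightarrow> real"
  assumes "smooth f" "\<And>x j. dq j f x = 0"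
  shows "f (t, q) = f (t, 0)"
  using affine_in_space[OF assms(1), of t "\<lambda>_. 0" q] assms(2) by simp

lemma affine_in_time_and_space:
  fixes f :: "'n::finite base \<Rightarrow> real"
  assumes f: "smooth f" and c: "\<And>x. dt f x = c" and a: "\<And>x j. dq j f x = a j"
  shows "f (t, q) = f (0, 0) + t * c + (\<Sum>j\<in>UNIV. q $ j * a j)"
  using increment_of_constant_partial[OF f, of "(t, q)" "(0, 0)" "t * c + (\<Sum>j\<in>UNIV. q $ j * a j)"]
  by (simp add: partial_split[OF f, of t q] slope_def a c)

lemma axis_component: "axis k (1::real) $ j = (if j = k then 1 else 0)"
  by (auto simp: axis_def)

text \<open>The second space derivatives of \<open>\<eta>\<^sub>1\<close> that the symmetry condition prescribes take this
  shape, with \<open>f\<close> and \<open>g\<close> derivatives of \<open>\<xi>\<close>, once vanishing terms are dropped; differentiating it once more is what makes the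
  compatibility argument work.\<close>

lemma dq_coordinate_combination:
  fixes f g :: "'n::finite base \<Rightarrow> real"
  assumes "smooth f" "smooth g"
  shows "dq j (\<lambda>x. c * f x + d * (snd x $ k * g x)) x
    = c * dq j f x + d * ((if j = k then g x else 0) + snd x $ k * dq j g x)"
proof -
  have "((\<lambda>x. c * f x + d * (snd x $ k * g x)) has_derivative
      (\<lambda>h. c * partial h f x + d * (snd x $ k * partial h g x + snd h $ k * g x))) (at x)"
    by (intro has_derivative_add has_derivative_mult_right has_derivative_mult
        partial_has_derivative assms bounded_linear_imp_has_derivative
        bounded_linear_compose[OF bounded_linear_vec_nth bounded_linear_snd])
  from partial_eqI[OF this] show ?thesis by (simp add: axis_component)
qed

section \<open>Total time derivatives\<close>

lemma total_deriv_eq: "total_deriv f (t, q, v) = dt f (t, q) + slope f (t, q) v"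
  by (simp add: total_deriv_def slope_def)

lemma total_deriv_has_derivative:
  fixes f :: "'n::finite base \<Rightarrow> real"
  assumes f: "smooth f"
  shows "(total_deriv f has_derivative (\<lambda>(s, y, z). partial (s, y) (dt f) (t, q)
    + (\<Sum>j\<in>UNIV. v $ j * partial (s, y) (dq j f) (t, q) + z $ j * dq j f (t, q)))) (at (t, q, v))"
proof -
  have P: "((\<lambda>p. (fst p, fst (snd p))) has_derivative (\<lambda>p. (fst p, fst (snd p)))) (at (t, q, v))"
    by (intro derivative_intros)
  have L: "((\<lambda>p. g (fst p, fst (snd p))) has_derivative
      (\<lambda>h. partial (fst h, fst (snd h)) g (t, q))) (at (t, q, v))" if "smooth g" for g :: "'n base \<Rightarrow> real"
    using has_derivative_compose[OF P, of g "\<lambda>h. partial h g (t, q)"]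
      partial_has_derivative[OF that, of "(t, q)"] by simp
  have V: "((\<lambda>p. snd (snd p) $ j) has_derivative (\<lambda>h. snd (snd h) $ j)) (at (t, q, v))" for j
    by (intro bounded_linear_imp_has_derivative bounded_linear_compose[OF bounded_linear_vec_nth]
        bounded_linear_compose[OF bounded_linear_snd] bounded_linear_snd)
  have M: "((\<lambda>p. snd (snd p) $ j * dq j f (fst p, fst (snd p))) has_derivative
      (\<lambda>h. v $ j * partial (fst h, fst (snd h)) (dq j f) (t, q) + snd (snd h) $ j * dq j f (t, q)))
      (at (t, q, v))" for j
    using has_derivative_mult[OF V L[OF smooth_dq[OF f]], of j j] by simp
  have "((\<lambda>p. dt f (fst p, fst (snd p)) + (\<Sum>j\<in>UNIV. snd (snd p) $ j * dq j f (fst p, fst (snd p))))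
      has_derivative (\<lambda>h. partial (fst h, fst (snd h)) (dt f) (t, q)
        + (\<Sum>j\<in>UNIV. v $ j * partial (fst h, fst (snd h)) (dq j f) (t, q)
            + snd (snd h) $ j * dq j f (t, q)))) (at (t, q, v))"
    by (intro has_derivative_add has_derivative_sum L M smooth_dt f)
  then show ?thesis
    by (simp add: total_deriv_def case_prod_unfold)
qed

lemma slope_zero_vector [simp]: "slope f x 0 = 0" by (simp add: slope_def)

lemma slope_axis: "slope f x (axis k 1) = dq k f x"
proof -
  have "slope f x (axis k 1) = (\<Sum>j\<in>UNIV. if j = k then dq j f x else 0)"
    unfolding slope_def by (intro sum.cong) (auto simp: axis_component)
  then show ?thesis by simp
qed

lemma slope_add: "slope f x (v + w) = slope f x v + slope f x w"
  by (simp add: slope_def algebra_simps sum.distrib)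

lemma slope_scale: "slope f x (s *\<^sub>R v) = s * slope f x v"
  by (simp add: slope_def sum_distrib_left algebra_simps)

lemma hess_scale: "hess f x (s *\<^sub>R v) = s * s * hess f x v"
  by (simp add: hess_def sum_distrib_left slope_scale algebra_simps)

text \<open>Commuting \<open>dt\<close> with \<open>dq j\<close> merges the two mixed sums into the factor 2, which exhibits the
  second total derivative as a polynomial in \<open>v\<close> and \<open>a\<close>.\<close>

lemma second_total_deriv:
  fixes f :: "'n::finite base \<Rightarrow> real"
  assumes f: "smooth f"
  shows "total_deriv1 (total_deriv f) (t, q, v, a)
    = dt (dt f) (t, q) + 2 * slope (dt f) (t, q) v + hess f (t, q) v + slope f (t, q) a"
proof -
  let ?x = "(t, q)"
  have P: "partial (s, y, z) (total_deriv f) (t, q, v) = partial (s, y) (dt f) ?x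
      + (\<Sum>j\<in>UNIV. v $ j * partial (s, y) (dq j f) ?x) + slope f ?x z" for s y z
    by (subst partial_eqI[OF total_deriv_has_derivative[OF f]]) (simp add: sum.distrib slope_def)
  have t: "partial (1, 0, 0) (total_deriv f) (t, q, v) = dt (dt f) ?x + slope (dt f) ?x v"
    by (simp add: P slope_def dq_dt[OF f])
  have p0: "partial (0, 0) g ?x = 0" if "smooth g" for g :: "'n base \<Rightarrow> real"
    using partial_split[OF that, of 0 0 ?x] by simp
  have q: "partial (0, axis k 1, 0) (total_deriv f) (t, q, v)
      = dq k (dt f) ?x + slope (dq k f) ?x v" for k
    by (simp add: P slope_def dq_dq[OF f, of k])
  have v: "partial (0, 0, axis k 1) (total_deriv f) (t, q, v) = dq k f ?x" for k
    by (simp add: P slope_axis p0 smooth_dt smooth_dq f)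
  show ?thesis
    unfolding total_deriv1_def
    by (simp add: t q v hess_def slope_def[of "dt f"] slope_def[of f] algebra_simps sum.distrib)
qed

text \<open>Polarization: a quadratic form is determined by its values on \<open>e\<^sub>j\<close> and \<open>e\<^sub>j + e\<^sub>k\<close>, and the
  matrix of second derivatives is symmetric.\<close>

lemma hess_zero_imp:
  fixes f :: "'n::finite base \<Rightarrow> real"
  assumes f: "smooth f" and H: "\<And>v. hess f x v = 0"
  shows "dq j (dq k f) x = 0"
proof -
  have s: "(\<Sum>i\<in>UNIV. axis j 1 $ i * c i) = c j" for j :: 'n and c :: "'n \<Rightarrow> real"
  proof -
    have "(\<Sum>i\<in>UNIV. axis j 1 $ i * c i) = (\<Sum>i\<in>UNIV. if i = j then c i else 0)"
      by (intro sum.cong) (auto simp: axis_component)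
    then show ?thesis by simp
  qed
  have d: "dq i (dq i f) x = 0" for i
    using H[of "axis i 1"] by (simp add: hess_def slope_axis s)
  have "hess f x (axis j 1 + axis k 1) = dq j (dq j f) x + dq k (dq j f) x
      + (dq j (dq k f) x + dq k (dq k f) x)"
    by (simp add: hess_def slope_add slope_axis distrib_right sum.distrib s)
  then show ?thesis using H d dq_dq[OF f, of j k] by simp
qed

section \<open>The determining equations, graded by degree in the velocity\<close>

lemma cubic_coefficients_zero:
  fixes k :: real
  assumes "\<And>s::real. k + s * l + s * s * b + s * s * s * c = 0"
  shows "k = 0" "l = 0" "b = 0" "c = 0"
  using assms[of 0] assms[of 1] assms[of "-1"] assms[of 2] by linarith+

definition acceleration :: "real^3 \<Rightarrow> real^3 \<Rightarrow> real^3" where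
  "acceleration q v = vector [q$1 * v$3, q$2 * v$3, - q$1 * v$1 - q$2 * v$2]"

text \<open>Replacing \<open>v\<close> by \<open>s v\<close> also replaces the eliminated acceleration by its \<open>s\<close>-fold. The symmetry
  condition thereby becomes a cubic polynomial in \<open>s\<close>, and the parts listed here are coefficients of it. In the quadratic part, the first prolongation cancels half of the term in the second
  prolongation that carries the acceleration times twice the total derivative of \<open>\<xi>\<close>; what remains has
  the same form for all three equations.\<close>

lemma
  fixes u :: "3 base \<Rightarrow> 3 base"
  assumes "lie_point_symmetry {eq1, eq2, eq3} u"
  defines "\<xi> \<equiv> xi u" and "\<eta> \<equiv> eta u"
  shows determining_constant: "dt (dt (\<eta> 1)) (t, q) - q$1 * dt (\<eta> 3) (t, q) = 0"
    and determining_linear1: "2 * slope (dt (\<eta> 1)) (t, q) v + slope (\<eta> 1) (t, q) (acceleration q v) - v$1 * dt (dt \<xi>) (t, q)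
      - \<eta> 1 (t, q) * v$3 - q$1 * slope (\<eta> 3) (t, q) v - q$1 * v$3 * dt \<xi> (t, q) = 0"
    and determining_linear2: "2 * slope (dt (\<eta> 2)) (t, q) v + slope (\<eta> 2) (t, q) (acceleration q v) - v$2 * dt (dt \<xi>) (t, q)
      - \<eta> 2 (t, q) * v$3 - q$2 * slope (\<eta> 3) (t, q) v - q$2 * v$3 * dt \<xi> (t, q) = 0"
    and determining_linear3: "2 * slope (dt (\<eta> 3)) (t, q) v + slope (\<eta> 3) (t, q) (acceleration q v) - v$3 * dt (dt \<xi>) (t, q)
      + \<eta> 1 (t, q) * v$1 + \<eta> 2 (t, q) * v$2
      + q$1 * slope (\<eta> 1) (t, q) v + q$2 * slope (\<eta> 2) (t, q) v
      + (q$1 * v$1 + q$2 * v$2) * dt \<xi> (t, q) = 0"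
    and determining_quadratic: "hess (\<eta> i) (t, q) v = v$i * (2 * slope (dt \<xi>) (t, q) v + slope \<xi> (t, q) (acceleration q v))
      + acceleration q v $ i * slope \<xi> (t, q) v"
    and determining_cubic: "v$i * hess \<xi> (t, q) v = 0"
proof -
  have u: "smooth u" using assms(1) unfolding lie_point_symmetry_explicit by blast
  have \<xi>: "smooth \<xi>" and \<eta>: "\<And>i. smooth (\<eta> i)"
    unfolding \<xi>_def \<eta>_def by (simp_all add: smooth_xi smooth_eta u)
  have acceleration_scale: "acceleration q (s *\<^sub>R v) = s *\<^sub>R acceleration q v" for s
    by (simp add: acceleration_def vec_eq_iff forall_3 algebra_simps)
  have acceleration_nth: "acceleration q v $ 1 = q$1 * v$3" "acceleration q v $ 2 = q$2 * v$3"
    "acceleration q v $ 3 = - q$1 * v$1 - q$2 * v$2" by (simp_all add: acceleration_def)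
  note E = assms(1)[unfolded lie_point_symmetry_explicit Let_def, THEN conjunct2, rule_format,
      OF refl, folded \<xi>_def \<eta>_def, of t q "s *\<^sub>R v" for s]
  have eliminated: "vector [q$1 * (s *\<^sub>R v)$3, q$2 * (s *\<^sub>R v)$3, - q$1 * (s *\<^sub>R v)$1 - q$2 * (s *\<^sub>R v)$2]
      = s *\<^sub>R acceleration q v" for s
    using acceleration_scale[of s] by (simp only: acceleration_def)
  note E = E[unfolded eliminated, unfolded second_total_deriv[OF \<xi>] second_total_deriv[OF \<eta>] total_deriv_eq
      slope_scale hess_scale vector_scaleR_component real_scaleR_def acceleration_nth]
  let ?x = "(t, q)"
  have C1: "(dt (dt (\<eta> 1)) ?x - q$1 * dt (\<eta> 3) ?x)
    + s * (2 * slope (dt (\<eta> 1)) ?x v + slope (\<eta> 1) ?x (acceleration q v) - v$1 * dt (dt \<xi>) ?x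
      - \<eta> 1 ?x * v$3 - q$1 * slope (\<eta> 3) ?x v - q$1 * v$3 * dt \<xi> ?x)
    + s * s * (hess (\<eta> 1) ?x v - v$1 * (2 * slope (dt \<xi>) ?x v + slope \<xi> ?x (acceleration q v))
      - q$1 * v$3 * slope \<xi> ?x v)
    + s * s * s * (- v$1 * hess \<xi> ?x v) = 0" for s
    using E[of s, THEN conjunct1] by (simp add: algebra_simps)
  have C2: "(dt (dt (\<eta> 2)) ?x - q$2 * dt (\<eta> 3) ?x)
    + s * (2 * slope (dt (\<eta> 2)) ?x v + slope (\<eta> 2) ?x (acceleration q v) - v$2 * dt (dt \<xi>) ?x
      - \<eta> 2 ?x * v$3 - q$2 * slope (\<eta> 3) ?x v - q$2 * v$3 * dt \<xi> ?x)
    + s * s * (hess (\<eta> 2) ?x v - v$2 * (2 * slope (dt \<xi>) ?x v + slope \<xi> ?x (acceleration q v))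
      - q$2 * v$3 * slope \<xi> ?x v)
    + s * s * s * (- v$2 * hess \<xi> ?x v) = 0" for s
    using E[of s, THEN conjunct2, THEN conjunct1] by (simp add: algebra_simps)
  have C3: "(dt (dt (\<eta> 3)) ?x + q$1 * dt (\<eta> 1) ?x + q$2 * dt (\<eta> 2) ?x)
    + s * (2 * slope (dt (\<eta> 3)) ?x v + slope (\<eta> 3) ?x (acceleration q v) - v$3 * dt (dt \<xi>) ?x
      + \<eta> 1 ?x * v$1 + \<eta> 2 ?x * v$2 + q$1 * slope (\<eta> 1) ?x v + q$2 * slope (\<eta> 2) ?x v
      + (q$1 * v$1 + q$2 * v$2) * dt \<xi> ?x)
    + s * s * (hess (\<eta> 3) ?x v - v$3 * (2 * slope (dt \<xi>) ?x v + slope \<xi> ?x (acceleration q v))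
      + (q$1 * v$1 + q$2 * v$2) * slope \<xi> ?x v)
    + s * s * s * (- v$3 * hess \<xi> ?x v) = 0" for s
    using E[of s, THEN conjunct2, THEN conjunct2] by (simp add: algebra_simps)
  note Z = cubic_coefficients_zero[OF C1] cubic_coefficients_zero[OF C2] cubic_coefficients_zero[OF C3]
  show "dt (dt (\<eta> 1)) (t, q) - q$1 * dt (\<eta> 3) (t, q) = 0" by (rule Z(1))
  show "2 * slope (dt (\<eta> 1)) (t, q) v + slope (\<eta> 1) (t, q) (acceleration q v) - v$1 * dt (dt \<xi>) (t, q)
      - \<eta> 1 (t, q) * v$3 - q$1 * slope (\<eta> 3) (t, q) v - q$1 * v$3 * dt \<xi> (t, q) = 0"
    "2 * slope (dt (\<eta> 2)) (t, q) v + slope (\<eta> 2) (t, q) (acceleration q v) - v$2 * dt (dt \<xi>) (t, q)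
      - \<eta> 2 (t, q) * v$3 - q$2 * slope (\<eta> 3) (t, q) v - q$2 * v$3 * dt \<xi> (t, q) = 0"
    "2 * slope (dt (\<eta> 3)) (t, q) v + slope (\<eta> 3) (t, q) (acceleration q v) - v$3 * dt (dt \<xi>) (t, q)
      + \<eta> 1 (t, q) * v$1 + \<eta> 2 (t, q) * v$2
      + q$1 * slope (\<eta> 1) (t, q) v + q$2 * slope (\<eta> 2) (t, q) v
      + (q$1 * v$1 + q$2 * v$2) * dt \<xi> (t, q) = 0"
    by (rule Z(2,6,10))+
  show "hess (\<eta> i) (t, q) v = v$i * (2 * slope (dt \<xi>) (t, q) v + slope \<xi> (t, q) (acceleration q v))
      + acceleration q v $ i * slope \<xi> (t, q) v"
    using Z(3,7,11) exhaust_3[of i] by (auto simp: acceleration_nth algebra_simps)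
  show "v$i * hess \<xi> (t, q) v = 0"
    using Z(4,8,12) exhaust_3[of i] by auto
qed

section \<open>Solving the determining equations\<close>

text \<open>The third derivatives of \<open>\<eta>\<^sub>1\<close> in the directions 122, 123 and 113 can each be obtained by
  differentiating two different prescribed second derivatives. One of the two results is zero, the
  other is a nonzero multiple of \<open>dq 3 \<xi>\<close>, \<open>dq 2 \<xi>\<close> and \<open>dq 1 \<xi>\<close> respectively.\<close>

lemma symmetry_time_coefficient:
  fixes u :: "3 base \<Rightarrow> 3 base"
  assumes S: "lie_point_symmetry {eq1, eq2, eq3} u"
  shows "dq j (xi u) x = 0"
proof -
  define \<xi> where "\<xi> = xi u"
  define h where "h = eta u 1"
  have u: "smooth u" using S unfolding lie_point_symmetry_explicit by blast
  have \<xi>: "smooth \<xi>" and h: "smooth h"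
    unfolding \<xi>_def h_def by (simp_all add: smooth_xi smooth_eta u)
  note smooth = smooth_dt smooth_dq \<xi> h
  \<comment> \<open>The cubic part carries a factor \<open>v$i\<close>; some component of a nonzero \<open>v\<close> can be cancelled.\<close>
  have "hess \<xi> y v = 0" for y v
  proof (cases "v = 0")
    case True
    then show ?thesis by (simp add: hess_def)
  next
    case False
    then obtain i where "v $ i \<noteq> 0" by (auto simp: vec_eq_iff)
    then show ?thesis using determining_cubic[OF S, of v i "fst y" "snd y"] by (simp add: \<xi>_def)
  qed
  then have \<xi>2: "dq i (dq k \<xi>) y = 0" for i k y by (rule hess_zero_imp[OF \<xi>])
  have \<xi>3: "dq i (dq k (dt \<xi>)) y = 0" for i k y
  proof -
    have "dq i (dq k (dt \<xi>)) = dt (dq i (dq k \<xi>))"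
      by (simp add: dq_dt smooth)
    also have "dq i (dq k \<xi>) = (\<lambda>_. 0)" using \<xi>2 by blast
    finally show ?thesis by (simp add: partial_const)
  qed
  note H = determining_quadratic[OF S, of 1, folded \<xi>_def h_def]
  note form = acceleration_def hess_def slope_def sum_3 axis_component
  have c: "dq 2 (dq 1 h) = dq 1 (dq 2 h)" "dq 3 (dq 1 h) = dq 1 (dq 3 h)" "dq 3 (dq 2 h) = dq 2 (dq 3 h)"
    by (rule dq_dq[OF h])+
  have h11: "dq 1 (dq 1 h) y = 2 * dq 1 (dt \<xi>) y - snd y $ 1 * dq 3 \<xi> y" for y
    using H[of "fst y" "snd y" "axis 1 1"] by (simp add: form)
  have h22: "dq 2 (dq 2 h) y = 0" for y
    using H[of "fst y" "snd y" "axis 2 1"] by (simp add: form)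
  have h33: "dq 3 (dq 3 h) y = snd y $ 1 * dq 3 \<xi> y" for y
    using H[of "fst y" "snd y" "axis 3 1"] by (simp add: form)
  \<comment> \<open>The vacuous factors 1 and 0 below bring the right-hand sides into the shape that
    \<open>dq_coordinate_combination\<close> differentiates.\<close>
  have h12: "dq 1 (dq 2 h) y = 1 * dq 2 (dt \<xi>) y + (- 1/2) * (snd y $ 2 * dq 3 \<xi> y)" for y
    using H[of "fst y" "snd y" "axis 1 1 + axis 2 1"] h11[of y] h22[of y]
    by (simp add: form c algebra_simps)
  have h13: "dq 1 (dq 3 h) y = dq 3 (dt \<xi>) y + snd y $ 1 * dq 1 \<xi> y + snd y $ 2 * dq 2 \<xi> y / 2" for y
    using H[of "fst y" "snd y" "axis 1 1 + axis 3 1"] h11[of y] h33[of y]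
    by (simp add: form c algebra_simps)
  have h23: "dq 2 (dq 3 h) y = 0 * dq 1 \<xi> y + (1/2) * (snd y $ 1 * dq 2 \<xi> y)" for y
    using H[of "fst y" "snd y" "axis 2 1 + axis 3 1"] h22[of y] h33[of y]
    by (simp add: form c algebra_simps)
  have "dq 3 \<xi> y = 0" for y
  proof -
    have "dq 2 (dq 1 (dq 2 h)) = dq 1 (dq 2 (dq 2 h))" by (rule dq_dq) (intro smooth)
    also have "dq 2 (dq 2 h) = (\<lambda>_. 0)" using h22 by blast
    finally have "dq 2 (dq 1 (dq 2 h)) y = 0" by (simp add: partial_const)
    then show ?thesis
      unfolding h12[abs_def] by (subst (asm) dq_coordinate_combination) (simp_all add: smooth \<xi>2 \<xi>3)
  qed
  note \<xi>_3 = this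
  then have d3: "dq 3 \<xi> = (\<lambda>_. 0)" by blast
  have "dq 2 \<xi> y = 0" for y
  proof -
    have "dq 1 (dq 2 (dq 3 h)) = dq 3 (dq 1 (dq 2 h))"
      by (simp add: dq_dq[of _ 3] smooth)
    moreover have "dq 1 (dq 2 h) = dq 2 (dt \<xi>)" using h12 by (auto simp: \<xi>_3)
    ultimately have "dq 1 (dq 2 (dq 3 h)) y = 0" by (simp add: \<xi>3)
    then show ?thesis
      unfolding h23[abs_def] by (subst (asm) dq_coordinate_combination) (simp_all add: smooth \<xi>2 \<xi>3)
  qed
  note \<xi>_2 = this
  have "dq 1 \<xi> y = 0" for y
  proof -
    have "dq 1 (dq 1 (dq 3 h)) = dq 3 (dq 1 (dq 1 h))"
      by (simp add: dq_dq[of _ 3] smooth)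
    moreover have "dq 1 (dq 1 h) = (\<lambda>y. 2 * dq 1 (dt \<xi>) y + 0 * (snd y $ 1 * dq 1 \<xi> y))"
      using h11 by (auto simp: \<xi>_3)
    ultimately have "dq 1 (dq 1 (dq 3 h)) y = 0"
      by (simp only:) (subst dq_coordinate_combination, simp_all add: smooth \<xi>3)
    moreover have "dq 1 (dq 3 h) = (\<lambda>y. 1 * dq 3 (dt \<xi>) y + 1 * (snd y $ 1 * dq 1 \<xi> y))"
      using h13 by (auto simp: \<xi>_2)
    ultimately show ?thesis
      by (simp only:) (subst (asm) dq_coordinate_combination, simp_all add: smooth \<xi>2 \<xi>3)
  qed
  then show ?thesis
    using \<xi>_2[of x] \<xi>_3[of x] exhaust_3[of j] unfolding \<xi>_def by metis
qed

lemma symmetry_space_coefficients: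
  fixes u :: "3 base \<Rightarrow> 3 base"
  assumes S: "lie_point_symmetry {eq1, eq2, eq3} u"
  shows "dq j (dq k (eta u i)) x = 0"
proof -
  have u: "smooth u" using S unfolding lie_point_symmetry_explicit by blast
  have "dq j (xi u) = (\<lambda>_. 0)" for j
    using symmetry_time_coefficient[OF S] by blast
  then have "slope (xi u) x v = 0" "slope (dt (xi u)) x v = 0" for x v
    by (simp_all add: slope_def dq_dt smooth_xi u partial_const)
  then have "hess (eta u i) x v = 0" for x v
    using determining_quadratic[OF S, of i "fst x" "snd x" v] by simp
  then show ?thesis by (rule hess_zero_imp[OF smooth_eta[OF u]])
qed

lemma symmetry_is_scaling_rotation_translation:
  fixes u :: "3 base \<Rightarrow> 3 base"
  assumes S: "lie_point_symmetry {eq1, eq2, eq3} u"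
  shows "\<exists>\<alpha> \<beta> \<gamma> \<delta>. \<forall>t q. u (t, q) =
       (- \<alpha> * t + \<beta>,
        vector [\<alpha> * q$1 + \<gamma> * q$2, - \<gamma> * q$1 + \<alpha> * q$2, \<alpha> * q$3 + \<delta>])"
proof -
  define \<xi> where "\<xi> = xi u"
  define \<eta> where "\<eta> = eta u"
  have u: "smooth u" using S unfolding lie_point_symmetry_explicit by blast
  have \<xi>: "smooth \<xi>" and \<eta>: "smooth (\<eta> i)" for i
    unfolding \<xi>_def \<eta>_def by (simp_all add: smooth_xi smooth_eta u)
  note smooth = smooth_dt smooth_dq \<xi> \<eta>
  have \<xi>q: "dq j \<xi> = (\<lambda>_. 0)" for j
    using symmetry_time_coefficient[OF S] unfolding \<xi>_def by blast
  have \<eta>qq: "dq j (dq k (\<eta> i)) = (\<lambda>_. 0)" for i j k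
    using symmetry_space_coefficients[OF S] unfolding \<eta>_def by blast
  \<comment> \<open>Space derivatives of \<open>\<eta>\<close> and time derivatives of \<open>\<xi>\<close> depend on \<open>t\<close> only, so they are given
    names that do not mention \<open>q\<close>.\<close>
  define A1 A2 where "A1 t = dt \<xi> (t, 0)" and "A2 t = dt (dt \<xi>) (t, 0)" for t
  define N M where "N i j t = dq j (\<eta> i) (t, 0)" and "M i j t = dq j (dt (\<eta> i)) (t, 0)" for i j t
  have A: "dt \<xi> (t, q) = A1 t" "dt (dt \<xi>) (t, q) = A2 t" for t q
    unfolding A1_def A2_def
    by (intro constant_in_space, simp_all add: smooth dq_dt \<xi>q partial_const)+
  have NM: "dq j (\<eta> i) (t, q) = N i j t" "dq j (dt (\<eta> i)) (t, q) = M i j t" for i j t q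
    unfolding N_def M_def
    by (intro constant_in_space, simp_all add: smooth dq_dt \<eta>qq partial_const)+
  note linear1 = determining_linear1[OF S, folded \<xi>_def \<eta>_def]
    and linear2 = determining_linear2[OF S, folded \<xi>_def \<eta>_def]
    and linear3 = determining_linear3[OF S, folded \<xi>_def \<eta>_def]
    and degree0 = determining_constant[OF S, folded \<xi>_def \<eta>_def]
  note ev = acceleration_def slope_def sum_3 axis_component A NM
  \<comment> \<open>Unit velocities pick out single coefficients of the linear parts: \<open>a\<close>, \<open>b\<close> and \<open>c\<close> stand for the
    three equations, the digit for the velocity component. The results are identities in \<open>q\<close>, to be
    evaluated at \<open>q = 0\<close> and at unit vectors.\<close>
  have a1: "2 * M 1 1 t - q$1 * N 1 3 t - A2 t - q$1 * N 3 1 t = 0" for t and q :: "real^3"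
    using linear1[of t q "axis 1 1"] by (simp add: ev algebra_simps)
  have a2: "2 * M 1 2 t - q$2 * N 1 3 t - q$1 * N 3 2 t = 0" for t and q :: "real^3"
    using linear1[of t q "axis 2 1"] by (simp add: ev algebra_simps)
  have a3: "2 * M 1 3 t + q$1 * N 1 1 t + q$2 * N 1 2 t - \<eta> 1 (t, q) - q$1 * N 3 3 t - q$1 * A1 t = 0"
    for t and q :: "real^3"
    using linear1[of t q "axis 3 1"] by (simp add: ev algebra_simps)
  have b1: "2 * M 2 1 t - q$1 * N 2 3 t - q$2 * N 3 1 t = 0" for t and q :: "real^3"
    using linear2[of t q "axis 1 1"] by (simp add: ev algebra_simps)
  have b3: "2 * M 2 3 t + q$1 * N 2 1 t + q$2 * N 2 2 t - \<eta> 2 (t, q) - q$2 * N 3 3 t - q$2 * A1 t = 0"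
    for t and q :: "real^3"
    using linear2[of t q "axis 3 1"] by (simp add: ev algebra_simps)
  have c1: "2 * M 3 1 t - q$1 * N 3 3 t + \<eta> 1 (t, q) + q$1 * N 1 1 t + q$2 * N 2 1 t + q$1 * A1 t = 0"
    for t and q :: "real^3"
    using linear3[of t q "axis 1 1"] by (simp add: ev algebra_simps)
  have c2: "2 * M 3 2 t - q$2 * N 3 3 t + \<eta> 2 (t, q) + q$1 * N 1 2 t + q$2 * N 2 2 t + q$2 * A1 t = 0"
    for t and q :: "real^3"
    using linear3[of t q "axis 2 1"] by (simp add: ev algebra_simps)
  have c3: "2 * M 3 3 t + q$1 * N 3 1 t + q$2 * N 3 2 t - A2 t + q$1 * N 1 3 t + q$2 * N 2 3 t = 0"
    for t and q :: "real^3"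
    using linear3[of t q "axis 3 1"] by (simp add: ev algebra_simps)
  have N13: "N 1 3 t = 0" and N32: "N 3 2 t = 0" and M12: "M 1 2 t = 0" for t
    using a2[of t 0] a2[of t "axis 1 1"] a2[of t "axis 2 1"] by (simp_all add: axis_component)
  have N23: "N 2 3 t = 0" and N31: "N 3 1 t = 0" and M21: "M 2 1 t = 0" for t
    using b1[of t 0] b1[of t "axis 1 1"] b1[of t "axis 2 1"] by (simp_all add: axis_component)
  have M_dt: "M i j t = dt (dq j (\<eta> i)) (t, q)" for i j t q
    using NM(2)[of j i t q] by (simp add: dq_dt[OF \<eta>])
  have M0: "M i j t = 0" if "\<And>t. N i j t = 0" for i j t
  proof -
    have "dq j (\<eta> i) = (\<lambda>_. 0)" using that NM(1) by fastforce
    then show ?thesis by (simp add: M_dt[of i j t 0] partial_const)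
  qed
  have M11: "2 * M 1 1 t = A2 t" for t using a1[of t 0] by simp
  have M33: "2 * M 3 3 t = A2 t" for t using c3[of t 0] by simp
  \<comment> \<open>Each of \<open>\<eta>\<^sub>1\<close>, \<open>\<eta>\<^sub>2\<close> is determined twice, by its own equation and by the third one; comparing
    the two expressions relates the entries of \<open>N\<close>.\<close>
  have \<eta>1: "\<eta> 1 (t, q) = q$1 * (N 1 1 t - N 3 3 t - A1 t) + q$2 * N 1 2 t" for t q
    using a3[of t q] M0[OF N13] by (simp add: algebra_simps)
  have \<eta>1': "\<eta> 1 (t, q) = q$1 * (N 3 3 t - N 1 1 t - A1 t) - q$2 * N 2 1 t" for t q
    using c1[of t q] M0[OF N31] by (simp add: algebra_simps)
  have \<eta>2: "\<eta> 2 (t, q) = q$2 * (N 2 2 t - N 3 3 t - A1 t) + q$1 * N 2 1 t" for t q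
    using b3[of t q] M0[OF N23] by (simp add: algebra_simps)
  have \<eta>2': "\<eta> 2 (t, q) = q$2 * (N 3 3 t - N 2 2 t - A1 t) - q$1 * N 1 2 t" for t q
    using c2[of t q] M0[OF N32] by (simp add: algebra_simps)
  have N33: "N 3 3 t = N 1 1 t" "N 3 3 t = N 2 2 t" for t
    using \<eta>1[of t "axis 1 1"] \<eta>1'[of t "axis 1 1"] \<eta>2[of t "axis 2 1"] \<eta>2'[of t "axis 2 1"]
    by (simp_all add: axis_component)
  have N21: "N 2 1 t = - N 1 2 t" for t
    using \<eta>1[of t "axis 2 1"] \<eta>1'[of t "axis 2 1"] by (simp add: axis_component)
  have N11: "N 1 1 t = - A1 t" for t
  proof -
    have "\<eta> 1 (t, axis 1 1) = \<eta> 1 (t, 0) + (\<Sum>j\<in>UNIV. axis 1 1 $ j * N 1 j t)"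
      by (rule affine_in_space[OF \<eta>]) (rule NM)
    then show ?thesis
      using \<eta>1[of t "axis 1 1"] \<eta>1[of t 0] by (simp add: sum_3 axis_component N33)
  qed
  \<comment> \<open>The time derivative of \<open>N 1 1\<close> is half of \<open>A2\<close> by the linear part, but its negative by the
    relation just found.\<close>
  have A2: "A2 t = 0" for t
  proof -
    have "dq 1 (\<eta> 1) = (\<lambda>x. - dt \<xi> x)"
      using N11 by (auto simp: NM A)
    then have "M 1 1 t = - A2 t"
      using partial_eqI[OF has_derivative_minus[OF partial_has_derivative[OF smooth_dt[OF \<xi>]]], of "(1, 0)" "(t, 0)"]
      by (simp add: M_dt[of 1 1 t 0] A)
    then show ?thesis using M11[of t] by simp
  qed
  define \<alpha> \<gamma> where "\<alpha> = - A1 0" and "\<gamma> = N 1 2 0"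
  have A1: "A1 t = - \<alpha>" for t
    using affine_in_time_and_space[of "dt \<xi>" 0 "\<lambda>_. 0" t 0]
    by (simp add: smooth dq_dt \<xi>q partial_const A A2 \<alpha>_def split_paired_all)
  have N12: "N 1 2 t = \<gamma>" for t
  proof -
    have "dt (dq 2 (\<eta> 1)) x = 0" for x
      using M_dt[of 1 2 "fst x" "snd x"] by (simp add: M12)
    then show ?thesis
      using affine_in_time_and_space[of "dq 2 (\<eta> 1)" 0 "\<lambda>_. 0" t 0]
      by (simp add: smooth \<eta>qq NM \<gamma>_def)
  qed
  have e1: "\<eta> 1 (t, q) = \<alpha> * q$1 + \<gamma> * q$2" for t q
    using \<eta>1[of t q] by (simp add: N33[of t] N11 A1 N12)
  have e2: "\<eta> 2 (t, q) = - \<gamma> * q$1 + \<alpha> * q$2" for t q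
    using \<eta>2[of t q] by (simp add: N33(2)[of t, symmetric] N33(1) N11 A1 N12 N21)
  have "dt (\<eta> 1) x = 0" for x
  proof -
    have "\<eta> 1 x = (\<lambda>y. \<alpha> * snd y$1 + \<gamma> * snd y$2) x" for x
      by (cases x) (simp add: e1)
    then have "\<eta> 1 = (\<lambda>y. \<alpha> * snd y$1 + \<gamma> * snd y$2)" by blast
    moreover have "((\<lambda>y. \<alpha> * snd y$1 + \<gamma> * snd y$2) has_derivative
        (\<lambda>y. \<alpha> * snd y$1 + \<gamma> * snd y$2)) (at x)"
      by (intro bounded_linear_imp_has_derivative bounded_linear_add
          bounded_linear_const_mult bounded_linear_compose[OF bounded_linear_vec_nth bounded_linear_snd])
    ultimately show ?thesis using partial_eqI by fastforce
  qed
  then have "dt (\<eta> 1) = (\<lambda>_. 0)" by blast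
  \<comment> \<open>The factor \<open>q$1\<close> is harmless because \<open>dt (\<eta> 3)\<close> does not depend on \<open>q\<close>: it suffices to look at
    a point with \<open>q$1 = 1\<close>.\<close>
  then have "q$1 * dt (\<eta> 3) (t, q) = 0" for t q
    using degree0[of t q] by (simp add: partial_const)
  note this[of "axis 1 1"]
  moreover have "dt (\<eta> 3) (t, q) = dt (\<eta> 3) (t, 0)" for t q
  proof (rule constant_in_space)
    have "M 3 j t = 0" for j t
      using exhaust_3[of j] M0[OF N31] M0[OF N32] M33 A2 by auto
    then show "dq j (dt (\<eta> 3)) x = 0" for x j
      using NM(2)[of j 3 "fst x" "snd x"] by simp
  qed (intro smooth)
  ultimately have e3t: "dt (\<eta> 3) x = 0" for x
    by (cases x) (metis axis_nth mult_1)
  have e3: "\<eta> 3 (t, q) = \<alpha> * q$3 + \<eta> 3 (0, 0)" for t q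
  proof -
    have "N 3 j t = (if j = 3 then \<alpha> else 0)" for j t
      using exhaust_3[of j] by (auto simp: N31 N32 N33(1) N11 A1)
    then have "dq j (\<eta> 3) x = (if j = 3 then \<alpha> else 0)" for j x
      using NM(1)[of j 3 "fst x" "snd x"] by simp
    from affine_in_time_and_space[OF \<eta> e3t this, of t q] show ?thesis
      by (simp add: sum_3 mult.commute)
  qed
  have x: "\<xi> (t, q) = - \<alpha> * t + \<xi> (0, 0)" for t q
    using affine_in_time_and_space[OF \<xi>, of "- \<alpha>" "\<lambda>_. 0" t q]
    by (simp add: \<xi>q A A1 split_paired_all)
  have "u (t, q) = (- \<alpha> * t + \<xi> (0, 0),
      vector [\<alpha> * q$1 + \<gamma> * q$2, - \<gamma> * q$1 + \<alpha> * q$2, \<alpha> * q$3 + \<eta> 3 (0, 0)])" for t q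
    using x[of t q] e1[of t q] e2[of t q] e3[of t q]
    by (simp add: prod_eq_iff vec_eq_iff forall_3 \<xi>_def \<eta>_def xi_def eta_def)
  then show ?thesis by blast
qed

theorem theorem3p1:
  fixes u :: "real \<times> (real^3) \<Rightarrow> real \<times> (real^3)"
  shows "lie_point_symmetry {eq1, eq2, eq3} u \<longleftrightarrow>
    (\<exists>\<alpha> \<beta> \<gamma> \<delta>. \<forall>t q. u (t, q) =
       (- \<alpha> * t + \<beta>,
        vector [\<alpha> * q$1 + \<gamma> * q$2, - \<gamma> * q$1 + \<alpha> * q$2, \<alpha> * q$3 + \<delta>]))"
proof
  assume "\<exists>\<alpha> \<beta> \<gamma> \<delta>. \<forall>t q. u (t, q) =
       (- \<alpha> * t + \<beta>,
        vector [\<alpha> * q$1 + \<gamma> * q$2, - \<gamma> * q$1 + \<alpha> * q$2, \<alpha> * q$3 + \<delta>])"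
  then obtain \<alpha> \<beta> \<gamma> \<delta> where u: "u (t, q) =
       (- \<alpha> * t + \<beta>,
        vector [\<alpha> * q$1 + \<gamma> * q$2, - \<gamma> * q$1 + \<alpha> * q$2, \<alpha> * q$3 + \<delta>])" for t q by blast
  define L :: "3 base \<Rightarrow> 3 base" where
    "L x = (- \<alpha> * fst x, vector [\<alpha> * snd x$1 + \<gamma> * snd x$2, - \<gamma> * snd x$1 + \<alpha> * snd x$2, \<alpha> * snd x$3])" for x
  define c :: "3 base" where "c = (\<beta>, vector [0, 0, \<delta>])"
  have "linear L"
    by (rule linearI) (simp_all add: L_def prod_eq_iff vec_eq_iff forall_3 algebra_simps)
  then have L: "bounded_linear L" by (simp add: linear_conv_bounded_linear)
  have u: "u = (\<lambda>x. L x + c)"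
    by (auto simp: fun_eq_iff u L_def c_def prod_eq_iff vec_eq_iff forall_3)
  have S: "smooth u" unfolding u by (rule smooth_affine[OF L])
  have X: "partial e (xi u) = (\<lambda>_. - \<alpha> * fst e)" for e
  proof -
    have "xi u = (\<lambda>x. fst (L x) + fst c)" by (auto simp: xi_def u)
    then show ?thesis
      using partial_affine[OF bounded_linear_compose[OF bounded_linear_fst L], of e "fst c"]
      by (simp add: L_def)
  qed
  have Y: "partial e (eta u i) = (\<lambda>_. snd (L e) $ i)" for e i
  proof -
    have "eta u i = (\<lambda>x. snd (L x) $ i + snd c $ i)" by (auto simp: eta_def u)
    then show ?thesis
      using partial_affine[OF bounded_linear_compose[OF bounded_linear_vec_nth
            bounded_linear_compose[OF bounded_linear_snd L]], of e i "snd c $ i"]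
      by simp
  qed
  have E: "eta u 1 (t, q) = \<alpha> * q$1 + \<gamma> * q$2" "eta u 2 (t, q) = - \<gamma> * q$1 + \<alpha> * q$2" for t q
    by (simp_all add: eta_def u L_def c_def)
  show "lie_point_symmetry {eq1, eq2, eq3} u"
    unfolding lie_point_symmetry_explicit Let_def
      second_total_deriv[OF smooth_xi[OF S]] second_total_deriv[OF smooth_eta[OF S]] total_deriv_eq
    by (auto simp: S X Y partial_const hess_def slope_def sum_3 L_def E axis_component algebra_simps)
qed (rule symmetry_is_scaling_rotation_translation)

end
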